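(* Let $r$ be a constant positive integer and let $s = s(n)$ be a positive-integer-valued function of $n$. If $u$ (for each $n$) is any sequence of length $s = s(n)$ with at most $r$ distinct letters, then $\operatorname{Ex}(u, n; n) = \Omega(n^{2-o(1)})$ if and only if $s(n) = \Omega(n^{1-o(1)})$.
   Context: All sequences are finite. A block is a contiguous subsequence of distinct letters (blocks may be empty). $\operatorname{Ex}(u, n; m)$ denotes the maximum possible length of a sequence on $n$ distinct letters that is partitioned into $m$ blocks (i.e. written as a concatenation of $m$ blocks) and that has no (not necessarily contiguous) subsequence isomorphic to $u$, where two sequences are isomorphic if one is obtained from the other by a one-to-one renaming of letters. Asymptotics are as $n \to \infty$; $f(n) = \Omega(n^{k-o(1)})$ means that for every $\varepsilon > 0$ one has $f(n) \geq n^{k-\varepsilon}$ for all sufficiently large $n$. *)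

theory Defs
  imports Complex_Main "HOL-Library.Sublist"
begin

definition seq_iso :: "'a list \<Rightarrow> 'b list \<Rightarrow> bool" where
  "seq_iso u w \<longleftrightarrow> (\<exists>f. inj_on f (set u) \<and> w = map f u)"

definition contains_seq :: "'b list \<Rightarrow> 'a list \<Rightarrow> bool" where
  "contains_seq v u \<longleftrightarrow> (\<exists>w. subseq w v \<and> seq_iso u w)"

definition partitioned_into_blocks :: "'a list \<Rightarrow> nat \<Rightarrow> bool" where
  "partitioned_into_blocks v m \<longleftrightarrow>
     (\<exists>bs. length bs = m \<and> (\<forall>b\<in>set bs. distinct b) \<and> concat bs = v)"

text \<open>
  The letters are taken to be natural numbers, which is no restriction up to isomorphism.
  A sequence on \<open>n\<close> distinct letters uses exactly \<open>n\<close> of them.  The lengths in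
  question are at most \<open>n * m\<close>, so the supremum is their maximum; it is \<open>0\<close> if there is
  no admissible sequence (for example if \<open>u\<close> has length 1 and \<open>n \<ge> 1\<close>).
\<close>

definition Ex_blocks :: "'a list \<Rightarrow> nat \<Rightarrow> nat \<Rightarrow> nat" where
  "Ex_blocks u n m = Sup {length v | v :: nat list.
     card (set v) = n \<and> partitioned_into_blocks v m \<and> \<not> contains_seq v u}"

text \<open>
  \<open>Omega_pow_minus_o1 f k\<close> says that \<open>f(n)\<close> is at least \<open>n\<close> to the power \<open>k - o(1)\<close>, up to
  a constant; a constant factor is absorbed by \<open>\<epsilon>\<close>, so none appears.
\<close>

definition Omega_pow_minus_o1 :: "(nat \<Rightarrow> real) \<Rightarrow> real \<Rightarrow> bool" where
  "Omega_pow_minus_o1 f k \<longleftrightarrow>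
     (\<forall>\<epsilon>>0. eventually (\<lambda>n. f n \<ge> real n powr (k - \<epsilon>)) sequentially)"

end

theory Submission
  imports Defs
begin

text \<open>
  Only two features of a pattern matter: its length \<open>s\<close> and the bound \<open>r\<close> on its number of
  letters.

  If \<open>s\<close> is large, some letter of the pattern occurs at least \<open>s / r\<close> times, by the pigeonhole
  principle.  A sequence in which every letter occurs fewer than \<open>s / r\<close> times therefore avoids the
  pattern, and repeating all \<open>n\<close> letters in about \<open>s / r\<close> blocks gives such a sequence of length
  about \<open>n s / r\<close> (lemmas \<open>exists_frequent_letter\<close> and \<open>Ex_blocks_ge\<close>).

  If \<open>s\<close> is small, regard a sequence in blocks as a bipartite graph that joins a letter to the
  blocks in which it occurs; as the letters of a block are distinct, the edges are counted by the
  length of the sequence.  If \<open>r\<close> letters all occur in \<open>s\<close> common blocks, then one letter of the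
  pattern can be read off from each of these blocks, in whatever order the block lists them.  So a
  sequence that avoids the pattern is a graph without a complete bipartite subgraph on \<open>r\<close> letters
  and \<open>s\<close> blocks, and the Kovari--Sos--Turan double count bounds its number of edges
  (lemmas \<open>contains_seq_if_common_blocks\<close> and \<open>avoiding_length_le\<close>).
  With \<open>n\<close> letters, \<open>n\<close> blocks and \<open>s < n\<^sup>1\<^sup>-\<^sup>\<epsilon>\<close> that bound is of order \<open>n\<close> to the power \<open>2 - \<epsilon> / r\<close>,
  so it is a fixed power below \<open>n\<^sup>2\<close>.
\<close>

section \<open>The extremal function as a maximum\<close>

lemma avoiding_lengths_finite:
  "finite {length v | v :: nat list.
     card (set v) = n \<and> partitioned_into_blocks v m \<and> \<not> contains_seq v u}"
proof (rule finite_subset)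
  show "{length v | v :: nat list.
     card (set v) = n \<and> partitioned_into_blocks v m \<and> \<not> contains_seq v u} \<subseteq> {..m * n}"
  proof clarsimp
    fix v :: "nat list"
    assume n: "n = card (set v)" and "partitioned_into_blocks v m"
    then obtain bs where bs: "length bs = m" "\<forall>b\<in>set bs. distinct b" "concat bs = v"
      by (auto simp: partitioned_into_blocks_def)
    have "length b \<le> card (set v)" if "b \<in> set bs" for b
    proof -
      have "card (set b) \<le> card (set v)"
        using that bs by (intro card_mono) auto
      then show ?thesis
        using that bs by (simp add: distinct_card)
    qed
    then have "sum_list (map length bs) \<le> sum_list (map (\<lambda>_. card (set v)) bs)"
      by (intro sum_list_mono) auto
    then show "length v \<le> m * card (set v)"
      using bs by (auto simp: length_concat sum_list_triv)
  qed
qed simp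

lemma length_le_Ex_blocks:
  fixes v :: "nat list"
  assumes "card (set v) = n" "partitioned_into_blocks v m" "\<not> contains_seq v u"
  shows "length v \<le> Ex_blocks u n m"
  unfolding Ex_blocks_def
  using assms
  by (intro cSup_upper bdd_above_finite avoiding_lengths_finite) blast

text \<open>The first case covers the absence of admissible sequences, where the supremum is \<open>0\<close>.\<close>

lemma Ex_blocks_attained:
  obtains "Ex_blocks u n m = 0"
  | v :: "nat list" where "card (set v) = n" "partitioned_into_blocks v m"
      "\<not> contains_seq v u" "length v = Ex_blocks u n m"
proof (cases "{length v | v :: nat list.
     card (set v) = n \<and> partitioned_into_blocks v m \<and> \<not> contains_seq v u} = {}")
  case True
  have "Ex_blocks u n m = 0"
    unfolding Ex_blocks_def True by (rule Sup_nat_empty)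
  then show ?thesis
    by (rule that(1))
next
  case False
  then have "Ex_blocks u n m \<in> {length v | v :: nat list.
     card (set v) = n \<and> partitioned_into_blocks v m \<and> \<not> contains_seq v u}"
    unfolding Ex_blocks_def cSup_eq_Max[OF avoiding_lengths_finite False]
    by (intro Max_in avoiding_lengths_finite)
  then obtain v :: "nat list" where "length v = Ex_blocks u n m" "card (set v) = n"
      "partitioned_into_blocks v m" "\<not> contains_seq v u"
    by auto
  then show ?thesis
    by (intro that(2))
qed

section \<open>Long sequences avoiding a pattern with a frequent letter\<close>

lemma exists_frequent_letter:
  assumes "card (set u) \<le> r" "u \<noteq> []"
  obtains a where "length u \<le> r * count_list u a"
proof -
  have "\<exists>a. length u \<le> r * count_list u a"
  proof (rule ccontr)
    assume "\<not> ?thesis"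
    then have small: "r * count_list u a < length u" for a
      by (meson not_le)
    have "r * length u = (\<Sum>a\<in>set u. r * count_list u a)"
      by (simp add: sum_distrib_left[symmetric] sum_count_set)
    also have "\<dots> < (\<Sum>a\<in>set u. length u)"
      using assms(2) by (intro sum_strict_mono small) auto
    also have "\<dots> \<le> r * length u"
      using assms(1) by simp
    finally show False
      by simp
  qed
  then show ?thesis
    using that by blast
qed

lemma count_list_le_if_contains_seq:
  assumes "contains_seq v u"
  shows "\<exists>b. count_list u a \<le> count_list v b"
proof -
  obtain f where f: "subseq (map f u) v"
    using assms by (auto simp: contains_seq_def seq_iso_def)
  have "count_list u a \<le> count_list (map f u) (f a)"
    by (rule count_list_map_ge)
  also have "\<dots> \<le> count_list v (f a)"
    using list_emb_length[OF subseq_filter[OF f]] by (simp add: count_list_eq_length_filter)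
  finally show ?thesis ..
qed

lemma count_list_concat_replicate:
  "count_list (concat (replicate c xs)) x = c * count_list xs x"
  by (induction c) auto

text \<open>
  The witness consists of \<open>c\<close> blocks containing every letter and \<open>m - c\<close> empty ones.  The
  restriction \<open>0 < c\<close> makes all \<open>n\<close> letters occur.
\<close>

lemma Ex_blocks_ge:
  assumes "0 < c" "c \<le> m" "c < count_list u a"
  shows "n * c \<le> Ex_blocks u n m"
proof -
  define v where "v = concat (replicate c [0..<n])"
  have "length v \<le> Ex_blocks u n m"
  proof (rule length_le_Ex_blocks)
    show "card (set v) = n"
      using assms(1) by (simp add: v_def)
    have "concat (replicate c [0..<n] @ replicate (m - c) []) = v"
      by (simp add: v_def)
    then show "partitioned_into_blocks v m"
      unfolding partitioned_into_blocks_def using assms(2)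
      by (intro exI[of _ "replicate c [0..<n] @ replicate (m - c) []"]) auto
    have "count_list v x \<le> c" for x
    proof -
      have "count_list [0..<n] x \<le> 1"
        by (induction n) auto
      then show ?thesis
        by (simp add: v_def count_list_concat_replicate)
    qed
    then show "\<not> contains_seq v u"
      using assms(3) count_list_le_if_contains_seq[of v u a] by (meson leD le_trans)
  qed
  then show ?thesis
    by (simp add: v_def length_concat sum_list_replicate mult.commute)
qed

section \<open>Sequences avoiding a short pattern are short\<close>

text \<open>Each block supplies one letter of \<open>w\<close>, so the order of the letters inside it is irrelevant.\<close>

lemma subseq_concat_if_letters_common:
  assumes "\<forall>b\<in>set bs. set w \<subseteq> set b" "length w \<le> length bs"
  shows "subseq w (concat bs)"
  using assms
proof (induction w arbitrary: bs)
  case (Cons x w)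
  then obtain b cs where bs: "bs = b # cs"
    by (cases bs) auto
  have "subseq [x] b"
    using Cons.prems bs by (simp add: subseq_singleton_left)
  moreover have "subseq w (concat cs)"
    using Cons.prems bs by (intro Cons.IH) auto
  ultimately have "subseq ([x] @ w) (b @ concat cs)"
    by (rule list_emb_append_mono)
  then show ?case
    using bs by simp
qed simp

lemma subseq_concat_filter: "subseq (concat (filter P bs)) (concat bs)"
  by (induction bs) (auto intro: list_emb_append_mono)

text \<open>
  Any injection of the letters of \<open>u\<close> into \<open>R\<close> gives a copy of \<open>u\<close> inside the blocks that
  contain \<open>R\<close>; dropping the other blocks only passes to a subsequence.
\<close>

lemma contains_seq_if_common_blocks:
  assumes "finite R" "card (set u) \<le> card R"
    and "length u \<le> length (filter (\<lambda>b. R \<subseteq> set b) bs)"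
  shows "contains_seq (concat bs) u"
proof -
  obtain f where f: "f ` set u \<subseteq> R" "inj_on f (set u)"
    using card_le_inj[OF _ assms(1,2)] by auto
  have "subseq (map f u) (concat (filter (\<lambda>b. R \<subseteq> set b) bs))"
    using f assms(3) by (intro subseq_concat_if_letters_common) auto
  then have "subseq (map f u) (concat bs)"
    using subseq_concat_filter subseq_order.trans by blast
  then show ?thesis
    using f by (auto simp: contains_seq_def seq_iso_def)
qed

text \<open>Counting the pairs of a block and an \<open>r\<close>-set of letters in it in two ways.\<close>

lemma sum_choose_blocks_eq:
  assumes "finite A" "\<forall>b\<in>set bs. distinct b \<and> set b \<subseteq> A"
  shows "(\<Sum>b\<leftarrow>bs. length b choose r) =
    (\<Sum>R\<in>{R. R \<subseteq> A \<and> card R = r}. length (filter (\<lambda>b. R \<subseteq> set b) bs))"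
  using assms(2)
proof (induction bs)
  case (Cons b bs)
  let ?F = "{R. R \<subseteq> A \<and> card R = r}"
  have fin: "finite ?F"
    using assms(1) by simp
  have "length b choose r = card {R. R \<subseteq> set b \<and> card R = r}"
    using Cons.prems by (simp add: n_subsets distinct_card)
  also have "{R. R \<subseteq> set b \<and> card R = r} = ?F \<inter> {R. R \<subseteq> set b}"
    using Cons.prems by auto
  also have "card \<dots> = (\<Sum>R\<in>?F. if R \<subseteq> set b then 1 else 0)"
    using fin by (simp add: sum.If_cases)
  finally have b: "length b choose r = (\<Sum>R\<in>?F. if R \<subseteq> set b then 1 else 0)" .
  have "length (filter (\<lambda>c. R \<subseteq> set c) (b # bs)) =
      (if R \<subseteq> set b then 1 else 0) + length (filter (\<lambda>c. R \<subseteq> set c) bs)" for R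
    by simp
  then show ?case
    using Cons b by (simp add: sum.distrib del: filter.simps)
qed simp

lemma sum_choose_blocks_le:
  assumes "\<forall>b\<in>set bs. distinct b" "\<not> contains_seq (concat bs) u" "card (set u) \<le> r"
    and "0 < r"
  shows "(\<Sum>b\<leftarrow>bs. length b choose r) \<le> card (set (concat bs)) ^ r * length u"
proof -
  let ?A = "set (concat bs)"
  have "length (filter (\<lambda>b. R \<subseteq> set b) bs) \<le> length u" if "card R = r" for R
    using contains_seq_if_common_blocks[of R u bs] assms that card_ge_0_finite[of R]
    by (metis assms(4) nat_le_linear)
  then have "(\<Sum>R\<in>{R. R \<subseteq> ?A \<and> card R = r}. length (filter (\<lambda>b. R \<subseteq> set b) bs))
      \<le> card {R. R \<subseteq> ?A \<and> card R = r} * length u"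
    by (intro sum_bounded_above[where K = "length u", simplified]) auto
  moreover have "(\<Sum>b\<leftarrow>bs. length b choose r) =
      (\<Sum>R\<in>{R. R \<subseteq> ?A \<and> card R = r}. length (filter (\<lambda>b. R \<subseteq> set b) bs))"
    using assms(1) by (intro sum_choose_blocks_eq) auto
  moreover have "card {R. R \<subseteq> ?A \<and> card R = r} = card ?A choose r"
    by (simp add: n_subsets)
  moreover have "card ?A choose r \<le> card ?A ^ r"
    by (cases "r \<le> card ?A") (auto simp: binomial_le_pow binomial_eq_0)
  ultimately show ?thesis
    by (metis (no_types, lifting) mult_le_mono1 order.trans)
qed

text \<open>
  A block of length at most \<open>T\<close> is paid for by the first summand.  In a longer one the binomial
  coefficient is at least \<open>(d / r) ^ r\<close>, hence at least \<open>d * T ^ (r - 1) / r ^ r\<close>.  This linear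
  bound takes the place of Jensen's inequality in the double count.
\<close>

lemma le_threshold_plus_choose:
  fixes d r :: nat and T :: real
  assumes "0 < r" "real r \<le> T"
  shows "real d \<le> T + real r ^ r / T ^ (r - 1) * real (d choose r)"
proof (cases "real d \<le> T")
  case True
  then show ?thesis
    using assms by (simp add: add_increasing2)
next
  case False
  then have T: "0 < T" "T \<le> real d" "r \<le> d"
    using assms by linarith+
  have "real d * T ^ (r - 1) \<le> real d * real d ^ (r - 1)"
    using T by (intro mult_left_mono power_mono) auto
  also have "\<dots> = real d ^ r"
    using power_minus_mult[OF assms(1), of "real d"] by (simp add: mult.commute)
  also have "\<dots> = real r ^ r * (real d / real r) ^ r"
    using assms(1) by (simp add: power_divide)
  also have "\<dots> \<le> real r ^ r * real (d choose r)"
    using binomial_ge_n_over_k_pow_k[OF T(3), where 'a = real]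
    by (intro mult_left_mono) auto
  finally have "real d \<le> real r ^ r / T ^ (r - 1) * real (d choose r)"
    using T by (simp add: field_simps)
  then show ?thesis
    using T by linarith
qed

lemma avoiding_length_le:
  fixes T :: real
  assumes "partitioned_into_blocks v m" "\<not> contains_seq v u" "card (set u) \<le> r"
    and "0 < r" "real r \<le> T"
  shows "real (length v) \<le>
    real m * T + real r ^ r / T ^ (r - 1) * (real (card (set v)) ^ r * real (length u))"
proof -
  obtain bs where bs: "length bs = m" "\<forall>b\<in>set bs. distinct b" "concat bs = v"
    using assms(1) by (auto simp: partitioned_into_blocks_def)
  let ?K = "real r ^ r / T ^ (r - 1)"
  have "real (length v) = (\<Sum>b\<leftarrow>bs. real (length b))"
    unfolding bs(3)[symmetric] by (induction bs) auto
  also have "\<dots> \<le> (\<Sum>b\<leftarrow>bs. T + ?K * real (length b choose r))"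
    using assms by (intro sum_list_mono le_threshold_plus_choose) auto
  also have "\<dots> = real m * T + ?K * real (\<Sum>b\<leftarrow>bs. length b choose r)"
    unfolding bs(1)[symmetric] by (induction bs) (auto simp: algebra_simps)
  also have "\<dots> \<le> real m * T + ?K * real (card (set v) ^ r * length u)"
    using sum_choose_blocks_le[of bs u r] bs assms
    by (intro add_left_mono mult_left_mono iffD2[OF of_nat_le_iff]) auto
  finally show ?thesis
    by simp
qed

text \<open>
  The threshold \<open>T = n powr (1 - \<epsilon> / r)\<close> balances the two summands of the preceding bound when
  \<open>m = n\<close> and \<open>s = n powr (1 - \<epsilon>)\<close>.
\<close>

lemma Ex_blocks_le_powr:
  assumes "card (set u) \<le> r" "0 < r" "0 < n"
    and s: "real (length u) \<le> real n powr (1 - \<epsilon>)"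
    and T: "real r \<le> real n powr (1 - \<epsilon> / r)"
  shows "real (Ex_blocks u n n) \<le> (1 + real r ^ r) * real n powr (2 - \<epsilon> / r)"
proof (cases u n n rule: Ex_blocks_attained)
  case 1
  then show ?thesis by simp
next
  case (2 v)
  let ?T = "real n powr (1 - \<epsilon> / r)"
  have "real (Ex_blocks u n n) \<le>
      real n * ?T + real r ^ r / ?T ^ (r - 1) * (real n ^ r * real (length u))"
    using avoiding_length_le[OF 2(2,3) assms(1,2) T] 2 by simp
  also have "\<dots> \<le> real n * ?T + real r ^ r / ?T ^ (r - 1) * (real n ^ r * real n powr (1 - \<epsilon>))"
    using s by (intro add_left_mono mult_left_mono) auto
  also have "real n * ?T = real n powr (2 - \<epsilon> / r)"
    using assms(3) by (simp add: powr_mult_base)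
  also have "real r ^ r / ?T ^ (r - 1) * (real n ^ r * real n powr (1 - \<epsilon>)) =
      real r ^ r * real n powr (2 - \<epsilon> / r)"
  proof -
    have "?T ^ (r - 1) = real n powr ((real r - 1) * (1 - \<epsilon> / r))"
      using assms(2,3) by (simp add: powr_power of_nat_diff)
    moreover have "real n ^ r = real n powr real r"
      using assms(3) by (simp add: powr_realpow)
    moreover have "real n powr (2 - \<epsilon> / r) =
        real n powr r * real n powr (1 - \<epsilon>) / real n powr ((real r - 1) * (1 - \<epsilon> / r))"
    proof -
      have "real r + (1 - \<epsilon>) - (real r - 1) * (1 - \<epsilon> / r) = 2 - \<epsilon> / r"
        using assms(2) by (simp add: field_simps)
      then show ?thesis
        by (metis powr_diff powr_add)
    qed
    ultimately show ?thesis
      by simp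
  qed
  finally show ?thesis
    by (simp add: algebra_simps)
qed

section \<open>The two growth conditions are equivalent\<close>

lemma eventually_const_le_powr:
  fixes C a :: real
  assumes "0 < a"
  shows "eventually (\<lambda>n. C \<le> real n powr a) sequentially"
proof -
  have "eventually (\<lambda>n. \<bar>C\<bar> powr (1 / a) \<le> real n) sequentially"
    using filterlim_real_sequentially by (simp only: filterlim_at_top)
  then show ?thesis
  proof eventually_elim
    case (elim n)
    have "\<bar>C\<bar> = (\<bar>C\<bar> powr (1 / a)) powr a"
      using assms by (simp add: powr_powr)
    also have "\<dots> \<le> real n powr a"
      using elim assms by (intro powr_mono2) auto
    finally show ?case
      by linarith
  qed
qed

text \<open>A larger \<open>\<epsilon>\<close> asks for less, so it suffices to treat small ones.\<close>

lemma Omega_pow_minus_o1_if_small: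
  assumes "\<And>\<epsilon>. 0 < \<epsilon> \<Longrightarrow> \<epsilon> < 1 \<Longrightarrow> eventually (\<lambda>n. f n \<ge> real n powr (k - \<epsilon>)) sequentially"
  shows "Omega_pow_minus_o1 f k"
  unfolding Omega_pow_minus_o1_def
proof (intro allI impI)
  fix \<epsilon> :: real
  assume "\<epsilon> > 0"
  then have "eventually (\<lambda>n. f n \<ge> real n powr (k - min \<epsilon> (1/2))) sequentially"
    by (intro assms) auto
  then show "eventually (\<lambda>n. f n \<ge> real n powr (k - \<epsilon>)) sequentially"
    using eventually_ge_at_top[of 1]
  proof eventually_elim
    case (elim n)
    have "real n powr (k - \<epsilon>) \<le> real n powr (k - min \<epsilon> (1/2))"
      using elim by (intro powr_mono) auto
    then show ?case
      using elim by linarith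
  qed
qed

lemma Ex_blocks_large_if_length_large:
  fixes u :: "nat \<Rightarrow> 'a list"
  assumes "0 < r" "\<And>n. card (set (u n)) \<le> r"
    and large: "Omega_pow_minus_o1 (\<lambda>n. real (length (u n))) 1"
  shows "Omega_pow_minus_o1 (\<lambda>n. real (Ex_blocks (u n) n n)) 2"
proof (rule Omega_pow_minus_o1_if_small)
  fix \<epsilon> :: real
  assume \<epsilon>: "0 < \<epsilon>" "\<epsilon> < 1"
  have "eventually (\<lambda>n. real (length (u n)) \<ge> real n powr (1 - \<epsilon> / 2)) sequentially"
    using large \<epsilon> by (simp add: Omega_pow_minus_o1_def)
  \<comment> \<open>Of this factor, \<open>r\<close> pays for the pigeonhole principle and \<open>2\<close> for using a letter one time
    less often than it occurs in the pattern.\<close>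
  moreover have "eventually (\<lambda>n. 2 * real r \<le> real n powr (\<epsilon> / 2)) sequentially"
    using \<epsilon> by (intro eventually_const_le_powr) simp
  ultimately show "eventually (\<lambda>n. real (Ex_blocks (u n) n n) \<ge> real n powr (2 - \<epsilon>)) sequentially"
    using eventually_ge_at_top[of 1]
  proof eventually_elim
    case (elim n)
    let ?x = "real n powr (1 - \<epsilon>)"
    have x: "1 \<le> ?x" "?x \<le> real n"
      using elim(3) \<epsilon> powr_mono[of "1 - \<epsilon>" 1 "real n"] by (auto intro: ge_one_powr_ge_zero)
    have "2 * real r * ?x \<le> real n powr (\<epsilon> / 2) * ?x"
      using elim(2) by (intro mult_right_mono) auto
    also have "\<dots> = real n powr (1 - \<epsilon> / 2)"
      by (simp add: powr_add[symmetric])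
    finally have len: "2 * real r * ?x \<le> real (length (u n))"
      using elim(1) by linarith
    have "0 < 2 * real r * ?x"
      using x assms(1) by (intro mult_pos_pos) auto
    then have "u n \<noteq> []"
      using len by auto
    then obtain a where a: "length (u n) \<le> r * count_list (u n) a"
      using exists_frequent_letter assms(2) by metis
    have "real r * (2 * ?x) \<le> real r * real (count_list (u n) a)"
      using len a by (metis (mono_tags, lifting) mult.commute mult.left_commute of_nat_le_iff
          of_nat_mult order.trans)
    then have cnt: "2 * ?x \<le> real (count_list (u n) a)"
      using assms(1) by simp
    \<comment> \<open>A letter can occur at most once in each of the \<open>n\<close> blocks.\<close>
    define c where "c = min (count_list (u n) a - 1) n"
    have xc: "?x \<le> real c"
      using cnt x by (auto simp: c_def min_def of_nat_diff)
    have "n * c \<le> Ex_blocks (u n) n n"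
      using xc x cnt by (intro Ex_blocks_ge[where a = a]) (auto simp: c_def)
    then have "real n * real c \<le> real (Ex_blocks (u n) n n)"
      by (metis of_nat_le_iff of_nat_mult)
    moreover have "real n powr (2 - \<epsilon>) = real n * ?x"
      using elim(3) by (simp add: powr_mult_base)
    moreover have "real n * ?x \<le> real n * real c"
      using xc by (intro mult_left_mono) auto
    ultimately show ?case
      by linarith
  qed
qed

lemma length_large_if_Ex_blocks_large:
  fixes u :: "nat \<Rightarrow> 'a list"
  assumes "0 < r" "\<And>n. card (set (u n)) \<le> r"
    and large: "Omega_pow_minus_o1 (\<lambda>n. real (Ex_blocks (u n) n n)) 2"
  shows "Omega_pow_minus_o1 (\<lambda>n. real (length (u n))) 1"
proof (rule Omega_pow_minus_o1_if_small)
  fix \<epsilon> :: real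
  assume \<epsilon>: "0 < \<epsilon>" "\<epsilon> < 1"
  define \<delta> where "\<delta> = \<epsilon> / r"
  have \<delta>: "0 < \<delta>" "\<delta> < 1"
    using \<epsilon> assms(1) by (auto simp: \<delta>_def field_simps)
  have "eventually (\<lambda>n. real (Ex_blocks (u n) n n) \<ge> real n powr (2 - \<delta> / 2)) sequentially"
    using large \<delta> by (simp add: Omega_pow_minus_o1_def)
  \<comment> \<open>Strictly more than the constant \<open>1 + r ^ r\<close> of the upper bound, for the final contradiction.\<close>
  moreover have "eventually (\<lambda>n. 2 + real r ^ r \<le> real n powr (\<delta> / 2)) sequentially"
    using \<delta> by (intro eventually_const_le_powr) simp
  moreover have "eventually (\<lambda>n. real r \<le> real n powr (1 - \<delta>)) sequentially"
    using \<delta> by (intro eventually_const_le_powr) simp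
  ultimately show "eventually (\<lambda>n. real (length (u n)) \<ge> real n powr (1 - \<epsilon>)) sequentially"
    using eventually_ge_at_top[of 1]
  proof eventually_elim
    case (elim n)
    show ?case
    proof (rule ccontr)
      assume "\<not> ?case"
      then have "real (Ex_blocks (u n) n n) \<le> (1 + real r ^ r) * real n powr (2 - \<delta>)"
        unfolding \<delta>_def using elim assms by (intro Ex_blocks_le_powr) (auto simp: \<delta>_def)
      also have "\<dots> < real n powr (\<delta> / 2) * real n powr (2 - \<delta>)"
        using elim by (intro mult_strict_right_mono) auto
      also have "\<dots> = real n powr (2 - \<delta> / 2)"
        by (simp add: powr_add[symmetric])
      finally show False
        using elim(1) by linarith
    qed
  qed
qed

theorem corollary3p6:
  fixes r :: nat and s :: "nat \<Rightarrow> nat" and u :: "nat \<Rightarrow> 'a list"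
  assumes "r > 0"
    and "\<And>n. s n > 0"
    and "\<And>n. length (u n) = s n"
    and "\<And>n. card (set (u n)) \<le> r"
  shows "Omega_pow_minus_o1 (\<lambda>n. real (Ex_blocks (u n) n n)) 2 \<longleftrightarrow>
         Omega_pow_minus_o1 (\<lambda>n. real (s n)) 1"
  using length_large_if_Ex_blocks_large[of r u] Ex_blocks_large_if_length_large[of r u] assms
  by auto

end
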